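(* The factorially normalized Bernoulli polynomials $b_n(x)=B_n(x)/n!$ are characterized by the following two properties: (i) $b_0(x)=1$ and $b_1(x)=x-\tfrac12$; (ii) for every integer $n>0$, the $n$-fold circular convolution of $b_1$ with itself is $(-1)^{n-1}b_n$, that is, $$b_n(x)=(-1)^{n-1}\,b_1^{\circledast n}(x)\qquad\text{for } x\in[0,1).$$ In other words, a sequence $(p_n)_{n\ge 0}$ of real polynomials satisfies $p_0(x)=1$, $p_1(x)=x-\tfrac12$ and $p_n(x)=(-1)^{n-1}p_1^{\circledast n}(x)$ for all $n\ge 1$ and $x\in[0,1)$ if and only if $p_n=b_n$ for all $n\ge 0$.
   Context: The Bernoulli polynomials $B_n(x)$ are defined by $\frac{\lambda e^{\lambda x}}{e^\lambda-1}=\sum_{n\ge0}\frac{B_n(x)}{n!}\lambda^n$ for $|\lambda|<2\pi$. The circle group $\mathbb{T}=\mathbb{R}/\mathbb{Z}$ is identified with $[0,1)$, with Lebesgue measure of total mass $1$. For integrable $f,g$ on $[0,1)$, the circular convolution is $(f\circledast g)(u)=\int_0^1 f(v)\,g(u-v)\,dv$, where $u-v$ is taken modulo $1$ in $[0,1)$. A polynomial is regarded as a function on $\mathbb{T}$ by restriction to $[0,1)$. The powers $f^{\circledast n}$ are the iterated circular convolutions of $f$ with itself: $f^{\circledast 1}=f$ and $f^{\circledast (n+1)}=f^{\circledast n}\circledast f$. *)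

theory Defs
  imports "HOL-Analysis.Analysis" "HOL-Complex_Analysis.Complex_Analysis"
begin

section \<open>Bernoulli polynomials\<close>

text \<open>
  The function \<open>l \<mapsto> l e\<^sup>l\<^sup>x / (e\<^sup>l - 1)\<close>. Its removable singularity at \<open>l = 0\<close> is
  filled with the limit 1, because Isabelle's \<open>0 / 0\<close> would give 0 there.
\<close>
definition bernoulli_gen :: "real \<Rightarrow> complex \<Rightarrow> complex" where
  "bernoulli_gen x l =
     (if l = 0 then 1 else l * exp (l * of_real x) / (exp l - 1))"

definition is_bernoulli_seq :: "(nat \<Rightarrow> real poly) \<Rightarrow> bool" where
  "is_bernoulli_seq B \<longleftrightarrow>
     (\<forall>x l. norm l < 2 * pi \<longrightarrow>
        (\<lambda>n. of_real (poly (B n) x) / fact n * l ^ n) sums bernoulli_gen x l)"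

text \<open>The description is shown to be proper in \<open>is_bernoulli_seq_bernoulli_poly\<close> below.\<close>
definition bernoulli_poly :: "nat \<Rightarrow> real poly" where
  "bernoulli_poly = (THE B. is_bernoulli_seq B)"

definition norm_bernoulli_poly :: "nat \<Rightarrow> real poly" where
  "norm_bernoulli_poly n = smult (1 / fact n) (bernoulli_poly n)"

lemma is_bernoulli_seq_unique:
  assumes "is_bernoulli_seq B" "is_bernoulli_seq C"
  shows "B = C"
proof -
  have "poly (B n) x = poly (C n) x" for n x
  proof (rule ccontr)
    assume neq: "poly (B n) x \<noteq> poly (C n) x"
    define d where "d = (\<lambda>n. complex_of_real (poly (B n) x) / fact n - of_real (poly (C n) x) / fact n)"
    have S: "(\<lambda>n. d n * l ^ n) sums 0" if "norm l < 2 * pi" for l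
    proof -
      have "(\<lambda>n. of_real (poly (B n) x) / fact n * l ^ n - of_real (poly (C n) x) / fact n * l ^ n)
              sums (bernoulli_gen x l - bernoulli_gen x l)"
        using assms that unfolding is_bernoulli_seq_def by (intro sums_diff) auto
      then show ?thesis by (simp add: d_def algebra_simps)
    qed
    have dn: "d n \<noteq> 0" using neq by (simp add: d_def divide_simps)
    have d0: "d 0 = 0" using S[of 0] by simp
    have "n > 0" using dn d0 by (cases n) auto
    have S': "(\<lambda>n. d n * (l - 0) ^ n) sums 0" if "norm (l - 0) < 2 * pi" for l
      using S that by simp
    obtain s where s: "0 < s" "\<And>z::complex. z \<in> cball 0 s - {0} \<Longrightarrow> (0::complex) \<noteq> 0"
      using powser_0_nonzero[of "2*pi" 0 d "\<lambda>_. 0" n, OF _ S' refl dn \<open>n > 0\<close>] pi_gt_zero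
      by (metis mult_pos_pos zero_less_numeral)
    have "of_real s \<in> cball 0 s - {0::complex}" using s(1) by auto
    then show False using s(2) by blast
  qed
  then show ?thesis by (auto simp: fun_eq_iff poly_eq_poly_eq_iff[symmetric])
qed

lemma bernoulli_gen_0_holomorphic: "bernoulli_gen 0 holomorphic_on ball 0 (2 * pi)"
proof -
  have nz: "exp l \<noteq> 1" if "l \<in> ball 0 (2 * pi) - {0}" for l :: complex
  proof
    assume "exp l = 1"
    then obtain n :: int where n: "Re l = 0" "Im l = of_int (2 * n) * pi"
      by (auto simp: exp_eq_1)
    then have "norm l = \<bar>of_int n\<bar> * (2 * pi)"
      by (simp add: cmod_def abs_mult)
    with that have "\<bar>real_of_int n\<bar> * (2 * pi) < 1 * (2 * pi)" by simp
    then have "\<bar>real_of_int n\<bar> < 1" by (subst (asm) mult_less_cancel_right) auto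
    then have "n = 0" by linarith
    with n that show False by (auto simp: complex_eq_iff)
  qed
  have lim: "(\<lambda>l::complex. l / (exp l - 1)) \<midarrow>0\<rightarrow> 1"
  proof -
    have "((exp :: complex \<Rightarrow> complex) has_field_derivative exp 0) (at 0)"
      by (rule DERIV_exp)
    then have "(\<lambda>l::complex. (exp l - 1) / l) \<midarrow>0\<rightarrow> 1"
      by (simp add: has_field_derivative_iff)
    from tendsto_inverse[OF this] show ?thesis by simp
  qed
  have "(\<lambda>y::complex. if y = 0 then 1 else y / (exp y - 1)) holomorphic_on ball 0 (2 * pi)"
    using nz by (intro removable_singularity lim open_ball holomorphic_intros) auto
  then show ?thesis
    by (simp add: bernoulli_gen_def[abs_def] cong: if_cong)
qed

lemma is_bernoulli_seq_exists: "\<exists>B. is_bernoulli_seq B"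
proof -
  define a where "a = (\<lambda>n. (deriv ^^ n) (bernoulli_gen 0) 0 / fact n)"
  have a: "(\<lambda>n. a n * l ^ n) sums bernoulli_gen 0 l" if "norm l < 2 * pi" for l
    using holomorphic_power_series[OF bernoulli_gen_0_holomorphic, of l] that
    by (simp add: a_def)
  have cnj: "cnj (bernoulli_gen 0 (cnj l)) = bernoulli_gen 0 l" for l
    by (simp add: bernoulli_gen_def exp_cnj)
  define r where "r = (\<lambda>n. Re (a n))"
  have r: "(\<lambda>n. of_real (r n) * l ^ n) sums bernoulli_gen 0 l" if l: "norm l < 2 * pi" for l
  proof -
    have "(\<lambda>n. cnj (a n * cnj l ^ n)) sums cnj (bernoulli_gen 0 (cnj l))"
      using a[of "cnj l"] l by (subst sums_cnj) simp
    then have "(\<lambda>n. cnj (a n) * l ^ n) sums bernoulli_gen 0 l" by (simp add: cnj)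
    from sums_mult[OF sums_add[OF a[OF l] this], of "1/2"]
    have "(\<lambda>n. (a n + cnj (a n)) / 2 * l ^ n) sums bernoulli_gen 0 l"
      by (simp add: algebra_simps add_divide_distrib)
    then show ?thesis by (simp add: complex_add_cnj r_def)
  qed
  define B where "B = (\<lambda>n. smult (fact n) (\<Sum>k\<le>n. monom (r k / fact (n - k)) (n - k)))"
  have "(\<lambda>n. of_real (poly (B n) x) / fact n * l ^ n) sums bernoulli_gen x l"
    if l: "norm l < 2 * pi" for x l
  proof -
    obtain \<rho> where \<rho>: "norm l < \<rho>" "\<rho> < 2 * pi" using dense[OF l] by blast
    have "0 < \<rho>" using \<rho>(1) by (meson norm_ge_zero le_less_trans)
    then have "norm (complex_of_real \<rho>) = \<rho>" by simp
    then have sr: "summable (\<lambda>n. norm (of_real (r n) * l ^ n))"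
      using r[of "of_real \<rho>"] \<rho> by (intro powser_insidea[of _ "of_real \<rho>"]) (auto dest: sums_summable)
    define e where "e = (\<lambda>n. (l * of_real x) ^ n /\<^sub>R fact n)"
    have e: "e sums exp (l * of_real x)" unfolding e_def by (rule exp_converges)
    have se: "summable (\<lambda>n. norm (e n))" unfolding e_def by (rule summable_norm_exp)
    have "(\<lambda>n. \<Sum>k\<le>n. (of_real (r k) * l ^ k) * e (n - k))
            sums ((\<Sum>k. of_real (r k) * l ^ k) * (\<Sum>k. e k))"
      by (rule Cauchy_product_sums[OF sr se])
    also have "(\<Sum>k. of_real (r k) * l ^ k) * (\<Sum>k. e k) = bernoulli_gen 0 l * exp (l * of_real x)"
      using r[OF l] e by (simp add: sums_iff)
    also have "\<dots> = bernoulli_gen x l" by (simp add: bernoulli_gen_def)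
    also have "(\<lambda>n. \<Sum>k\<le>n. (of_real (r k) * l ^ k) * e (n - k)) =
               (\<lambda>n. of_real (poly (B n) x) / fact n * l ^ n)"
    proof
      fix n
      have "of_real (poly (B n) x) / fact n * l ^ n =
            (\<Sum>k\<le>n. of_real (r k) / fact (n - k) * of_real x ^ (n - k) * l ^ n)"
        by (simp add: B_def poly_sum poly_monom sum_distrib_right)
      also have "\<dots> = (\<Sum>k\<le>n. (of_real (r k) * l ^ k) * e (n - k))"
      proof (rule sum.cong)
        fix k assume "k \<in> {..n}"
        then have "l ^ n = l ^ k * l ^ (n - k)" by (simp flip: power_add)
        then show "of_real (r k) / fact (n - k) * of_real x ^ (n - k) * l ^ n =
                   (of_real (r k) * l ^ k) * e (n - k)"
          by (simp add: e_def power_mult_distrib scaleR_conv_of_real field_simps)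
      qed simp
      finally show "(\<Sum>k\<le>n. (of_real (r k) * l ^ k) * e (n - k)) =
                    of_real (poly (B n) x) / fact n * l ^ n" by simp
    qed
    finally show ?thesis .
  qed
  then show ?thesis unfolding is_bernoulli_seq_def by blast
qed

lemma is_bernoulli_seq_bernoulli_poly: "is_bernoulli_seq bernoulli_poly"
  unfolding bernoulli_poly_def
  using is_bernoulli_seq_exists is_bernoulli_seq_unique by (rule theI'[OF ex_ex1I])

section \<open>Circular convolution\<close>

text \<open>
  Functions on the circle are represented by functions on the reals of which only the values on
  \<open>[0,1)\<close> matter; \<open>frac\<close> reduces modulo 1 into \<open>[0,1)\<close>.
\<close>
definition circ_conv :: "(real \<Rightarrow> real) \<Rightarrow> (real \<Rightarrow> real) \<Rightarrow> real \<Rightarrow> real" where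
  "circ_conv f g u = (LINT v:{0..<1}|lebesgue. f v * g (frac (u - v)))"

text \<open>Convolution powers exist for positive exponents only; exponent 0 is left unspecified.\<close>
fun circ_power :: "(real \<Rightarrow> real) \<Rightarrow> nat \<Rightarrow> real \<Rightarrow> real" where
  "circ_power f (Suc 0) = f"
| "circ_power f (Suc (Suc n)) = circ_conv (circ_power f (Suc n)) f"

end

theory Submission
  imports Defs
begin

text \<open>
  Put \<open>b\<^sub>n = B\<^sub>n / n!\<close>. Comparing coefficients in
  \<open>bernoulli_gen x l = bernoulli_gen 0 l * exp (l * x)\<close> and in
  \<open>bernoulli_gen 1 l - bernoulli_gen 0 l = l\<close> yields the three facts that are needed:
  \<open>b\<^sub>0 = 1\<close>, \<open>b\<^sub>n\<^sub>+\<^sub>1' = b\<^sub>n\<close>, and \<open>b\<^sub>n(1) - b\<^sub>n(0)\<close> is 1 for \<open>n = 1\<close> and 0 otherwise. In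
  particular \<open>b\<^sub>1(x) = x - 1/2\<close>.

  For \<open>u\<close>, \<open>v\<close> in \<open>[0,1)\<close>, the factor \<open>b\<^sub>1(frac (u - v))\<close> is \<open>u - v - 1/2\<close> if \<open>v \<le> u\<close> and
  \<open>u - v + 1/2\<close> if \<open>v > u\<close>. On each piece, \<open>b\<^sub>n(v) (u - v + c)\<close> has the antiderivative
  \<open>b\<^sub>n\<^sub>+\<^sub>1(v) (u - v + c) + b\<^sub>n\<^sub>+\<^sub>2(v)\<close>. Since \<open>b\<^sub>n\<^sub>+\<^sub>1\<close> and \<open>b\<^sub>n\<^sub>+\<^sub>2\<close> are periodic at the end points
  for \<open>n \<ge> 1\<close>, only the jump at \<open>v = u\<close> survives, and \<open>b\<^sub>n \<circledast> b\<^sub>1 = - b\<^sub>n\<^sub>+\<^sub>1\<close>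
  (\<open>circ_conv_norm_bernoulli_poly\<close>). Induction on \<open>n\<close> gives the convolution powers of \<open>b\<^sub>1\<close>; the
  converse holds because two polynomials that agree on the infinite set \<open>[0,1)\<close> are equal.
\<close>

section \<open>Uniqueness of power series coefficients\<close>

lemma powser_sums_0_imp_coeff_0:
  fixes d :: "nat \<Rightarrow> complex"
  assumes "r > 0" and S: "\<And>l. norm l < r \<Longrightarrow> (\<lambda>n. d n * l ^ n) sums 0"
  shows "d n = 0"
proof (rule ccontr)
  assume dn: "d n \<noteq> 0"
  have "d 0 = 0" using S[of 0] \<open>r > 0\<close> by simp
  with dn have "n > 0" by (cases n) auto
  have S': "(\<lambda>n. d n * (l - 0) ^ n) sums 0" if "norm (l - 0) < r" for l
    using S that by simp
  \<comment> \<open>A power series with a nonzero coefficient has no zero in some punctured disc, but the sum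
    here is the zero function.\<close>
  obtain s where s: "0 < s" "\<And>z::complex. z \<in> cball 0 s - {0} \<Longrightarrow> (0::complex) \<noteq> 0"
    using powser_0_nonzero[of r 0 d "\<lambda>_. 0" n, OF \<open>r > 0\<close> S' refl dn \<open>n > 0\<close>] by metis
  have "of_real s \<in> cball 0 s - {0::complex}" using s(1) by auto
  then show False using s(2) by blast
qed

lemma powser_coeffs_unique:
  fixes c d :: "nat \<Rightarrow> complex"
  assumes "r > 0"
    and "\<And>l. norm l < r \<Longrightarrow> (\<lambda>n. c n * l ^ n) sums F l"
    and "\<And>l. norm l < r \<Longrightarrow> (\<lambda>n. d n * l ^ n) sums F l"
  shows "c n = d n"
proof -
  have "(\<lambda>n. (c n - d n) * l ^ n) sums 0" if "norm l < r" for l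
    using sums_diff[OF assms(2,3)[OF that]] by (simp add: algebra_simps)
  from powser_sums_0_imp_coeff_0[OF \<open>r > 0\<close> this] show ?thesis by simp
qed

section \<open>Normalized Bernoulli polynomials\<close>

lemma norm_bernoulli_poly_sums:
  assumes "norm l < 2 * pi"
  shows "(\<lambda>n. of_real (poly (norm_bernoulli_poly n) x) * l ^ n) sums bernoulli_gen x l"
  using is_bernoulli_seq_bernoulli_poly assms
  by (simp add: is_bernoulli_seq_def norm_bernoulli_poly_def)

text \<open>
  This is the Cauchy product of the series of \<open>bernoulli_gen 0 l\<close> and \<open>exp (l * x)\<close>, read off
  coefficientwise.
\<close>
lemma norm_bernoulli_poly_expansion:
  "norm_bernoulli_poly n =
     (\<Sum>k\<le>n. monom (poly (norm_bernoulli_poly k) 0 / fact (n - k)) (n - k))"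
proof -
  define r where "r k = poly (norm_bernoulli_poly k) 0" for k
  have "poly (norm_bernoulli_poly n) x = (\<Sum>k\<le>n. r k / fact (n - k) * x ^ (n - k))" for x
  proof -
    define c where "c n = (\<Sum>k\<le>n. complex_of_real (r k) *
        (of_real x ^ (n - k) /\<^sub>R fact (n - k)))" for n
    have c: "(\<lambda>n. c n * l ^ n) sums bernoulli_gen x l" if l: "norm l < 2 * pi" for l
    proof -
      define e where "e n = (l * of_real x) ^ n /\<^sub>R fact n" for n
      have r: "(\<lambda>n. of_real (r n) * l ^ n) sums bernoulli_gen 0 l"
        unfolding r_def by (rule norm_bernoulli_poly_sums[OF l])
      \<comment> \<open>A point strictly between \<open>norm l\<close> and the radius makes the series at \<open>l\<close> absolutely
        summable, as the Cauchy product requires.\<close>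
      obtain \<rho> where \<rho>: "norm l < \<rho>" "\<rho> < 2 * pi" using dense[OF l] by blast
      then have "norm (complex_of_real \<rho>) = \<rho>"
        by (metis abs_of_nonneg less_imp_le norm_ge_zero norm_of_real order_trans)
      then have "summable (\<lambda>n. norm (of_real (r n) * l ^ n))"
        using norm_bernoulli_poly_sums[of "of_real \<rho>" 0] \<rho> unfolding r_def
        by (intro powser_insidea[of _ "of_real \<rho>"]) (auto dest: sums_summable)
      moreover have "summable (\<lambda>n. norm (e n))"
        unfolding e_def by (rule summable_norm_exp)
      ultimately have "(\<lambda>n. \<Sum>k\<le>n. (of_real (r k) * l ^ k) * e (n - k))
          sums ((\<Sum>k. of_real (r k) * l ^ k) * (\<Sum>k. e k))"
        by (rule Cauchy_product_sums)
      also have "(\<Sum>k. of_real (r k) * l ^ k) = bernoulli_gen 0 l"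
        using r by (simp add: sums_iff)
      also have "(\<Sum>k. e k) = exp (l * of_real x)"
        unfolding e_def using exp_converges[of "l * of_real x"] by (simp add: sums_iff)
      also have "bernoulli_gen 0 l * exp (l * of_real x) = bernoulli_gen x l"
        by (simp add: bernoulli_gen_def)
      also have "(\<lambda>n. \<Sum>k\<le>n. (of_real (r k) * l ^ k) * e (n - k)) =
          (\<lambda>n. c n * l ^ n)"
        unfolding c_def sum_distrib_right
      proof (intro ext sum.cong)
        fix n k :: nat assume "k \<in> {..n}"
        then have "l ^ n = l ^ k * l ^ (n - k)" by (simp flip: power_add)
        then show "(of_real (r k) * l ^ k) * e (n - k) =
            of_real (r k) * (of_real x ^ (n - k) /\<^sub>R fact (n - k)) * l ^ n"
          by (simp add: e_def power_mult_distrib)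
      qed simp
      finally show ?thesis .
    qed
    have "complex_of_real (poly (norm_bernoulli_poly n) x) = c n"
      by (rule powser_coeffs_unique[OF _ norm_bernoulli_poly_sums c]) auto
    also have "\<dots> = of_real (\<Sum>k\<le>n. r k / fact (n - k) * x ^ (n - k))"
      by (simp add: c_def scaleR_conv_of_real field_simps)
    finally show ?thesis by (simp only: of_real_eq_iff)
  qed
  then show ?thesis
    by (simp add: fun_eq_iff poly_sum poly_monom r_def flip: poly_eq_poly_eq_iff)
qed

lemma norm_bernoulli_poly_0: "norm_bernoulli_poly 0 = 1"
proof -
  have "poly (norm_bernoulli_poly 0) x = 1" for x
    using norm_bernoulli_poly_sums[of 0 x] by (simp add: bernoulli_gen_def)
  then show ?thesis by (simp add: fun_eq_iff flip: poly_eq_poly_eq_iff)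
qed

lemma pderiv_norm_bernoulli_poly:
  "pderiv (norm_bernoulli_poly (Suc n)) = norm_bernoulli_poly n"
proof -
  define r where "r k = poly (norm_bernoulli_poly k) 0" for k
  have "pderiv (norm_bernoulli_poly (Suc n)) =
      (\<Sum>k\<le>Suc n. pderiv (monom (r k / fact (Suc n - k)) (Suc n - k)))"
    by (subst norm_bernoulli_poly_expansion)
      (simp add: r_def higher_pderiv_sum[of 1, simplified] del: sum.atMost_Suc)
  also have "\<dots> = (\<Sum>k\<le>n. monom (r k / fact (n - k)) (n - k))"
  proof -
    have deriv: "pderiv (monom (a / fact (Suc m)) (Suc m)) = monom (a / fact m) m"
      for a :: real and m
    proof -
      have "real (Suc m) * (a / fact (Suc m)) = a / fact m"
        unfolding fact_Suc of_nat_mult by (simp del: of_nat_Suc)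
      then show ?thesis by (simp only: pderiv_monom diff_Suc_1)
    qed
    have "pderiv (monom (r k / fact (Suc n - k)) (Suc n - k)) =
        monom (r k / fact (n - k)) (n - k)" if "k \<le> n" for k
      unfolding Suc_diff_le[OF that] by (rule deriv)
    then have "(\<Sum>k\<le>n. pderiv (monom (r k / fact (Suc n - k)) (Suc n - k))) =
        (\<Sum>k\<le>n. monom (r k / fact (n - k)) (n - k))"
      by (intro sum.cong) auto
    then show ?thesis by (simp only: sum.atMost_Suc) (simp add: pderiv_monom)
  qed
  also have "\<dots> = norm_bernoulli_poly n"
    unfolding r_def by (rule norm_bernoulli_poly_expansion[symmetric])
  finally show ?thesis .
qed

text \<open>For \<open>n \<noteq> 1\<close> the restriction of \<open>b\<^sub>n\<close> to \<open>[0,1)\<close> is thus continuous on the circle.\<close>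
lemma norm_bernoulli_poly_jump:
  "poly (norm_bernoulli_poly n) 1 - poly (norm_bernoulli_poly n) 0 = (if n = 1 then 1 else 0)"
proof -
  have nz: "exp l \<noteq> 1" if "norm l < 2 * pi" "l \<noteq> 0" for l :: complex
    using exp_complex_eqI[of l 0] abs_Im_le_cmod[of l] that by auto
  define c where "c n = complex_of_real (poly (norm_bernoulli_poly n) 1 -
    poly (norm_bernoulli_poly n) 0)" for n
  define d :: "nat \<Rightarrow> complex" where "d n = (if n = 1 then 1 else 0)" for n
  have "c n = d n"
  proof (rule powser_coeffs_unique[where r = "2 * pi" and F = "\<lambda>l. l"])
    fix l :: complex assume l: "norm l < 2 * pi"
    have "bernoulli_gen 1 l - bernoulli_gen 0 l = l"
      using nz[OF l] by (auto simp: bernoulli_gen_def field_simps)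
    then show "(\<lambda>n. c n * l ^ n) sums l"
      using sums_diff[OF norm_bernoulli_poly_sums[OF l, of 1] norm_bernoulli_poly_sums[OF l, of 0]]
      by (simp add: c_def algebra_simps)
    have "(\<lambda>n. d n * l ^ n) = (\<lambda>n. if n = 1 then l ^ n else 0)"
      by (auto simp: d_def)
    then show "(\<lambda>n. d n * l ^ n) sums l"
      using sums_single[of 1 "\<lambda>n. l ^ n"] by simp
  qed simp
  then show ?thesis
    unfolding c_def d_def by (metis of_real_eq_iff of_real_0 of_real_1)
qed

text \<open>The constant term of \<open>b\<^sub>1\<close> is determined by \<open>b\<^sub>2(1) = b\<^sub>2(0)\<close>.\<close>
lemma norm_bernoulli_poly_1: "norm_bernoulli_poly 1 = [:- 1 / 2, 1:]"
proof -
  define c where "c = poly (norm_bernoulli_poly 1) 0"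
  have b1: "norm_bernoulli_poly 1 = [:c, 1:]"
    by (subst norm_bernoulli_poly_expansion)
      (simp add: c_def norm_bernoulli_poly_0 monom_altdef)
  have "norm_bernoulli_poly 2 = [:poly (norm_bernoulli_poly 2) 0, c, 1 / 2:]"
    by (subst norm_bernoulli_poly_expansion)
      (simp add: c_def norm_bernoulli_poly_0 monom_altdef numeral_2_eq_2)
  then obtain d where "norm_bernoulli_poly 2 = [:d, c, 1 / 2:]" by blast
  then have "poly (norm_bernoulli_poly 2) 1 - poly (norm_bernoulli_poly 2) 0 = c + 1 / 2"
    by simp
  with norm_bernoulli_poly_jump[of 2] have "c = - 1 / 2" by simp
  with b1 show ?thesis by simp
qed

section \<open>Convolution with the sawtooth function\<close>

text \<open>
  On the circle, \<open>x - 1/2\<close> is a sawtooth with its jump at 0, so the integrand of the convolution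
  jumps at \<open>v = u\<close>; splitting there replaces \<open>frac\<close> by linear functions.
\<close>
lemma circ_conv_sawtooth:
  fixes f :: "real \<Rightarrow> real"
  assumes u: "u \<in> {0..<1}" and f: "continuous_on {0..1} f"
  shows "circ_conv f (poly [:- 1 / 2, 1:]) u =
    integral {0..u} (\<lambda>v. f v * (u - v - 1 / 2)) + integral {u..1} (\<lambda>v. f v * (u - v + 1 / 2))"
proof -
  define g where "g v = f v * poly [:- 1 / 2, 1:] (frac (u - v))" for v
  define g1 where "g1 v = f v * (u - v - 1 / 2)" for v
  define g2 where "g2 v = f v * (u - v + 1 / 2)" for v
  have g1: "g v = g1 v" if "v \<in> {0..u}" for v
  proof -
    from that u have "frac (u - v) = u - v" by (simp add: frac_eq)
    then show ?thesis by (simp add: g_def g1_def)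
  qed
  have g2: "g v = g2 v" if "v \<in> {u<..<1}" for v
  proof -
    from that u have "frac (u - v) = u - v + 1" by (simp add: frac_unique_iff)
    then show ?thesis by (simp add: g_def g2_def)
  qed
  have "continuous_on {0..u} g1" "continuous_on {u..1} g2"
    unfolding g1_def g2_def
    using u by (auto intro!: continuous_intros continuous_on_subset[OF f])
  then have "set_integrable lebesgue {0..u} g1" "set_integrable lebesgue {u..1} g2"
    by (auto intro: absolutely_integrable_continuous_real)
  then have i1: "set_integrable lebesgue {0..u} g1" and i2: "set_integrable lebesgue {u<..<1} g2"
    by (auto elim: set_integrable_subset)
  have i1': "set_integrable lebesgue {0..u} g"
    using i1 g1 set_integrable_cong[of lebesgue lebesgue "{0..u}" "{0..u}" g g1] by simp
  have i2': "set_integrable lebesgue {u<..<1} g"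
    using i2 g2 set_integrable_cong[of lebesgue lebesgue "{u<..<1}" "{u<..<1}" g g2] by simp
  have "circ_conv f (poly [:- 1 / 2, 1:]) u = (LINT v:{0..u} \<union> {u<..<1}|lebesgue. g v)"
  proof -
    have "{0..<1} = {0..u} \<union> {u<..<1}" using u by auto
    then show ?thesis by (simp add: circ_conv_def g_def)
  qed
  also have "\<dots> = (LINT v:{0..u}|lebesgue. g v) + (LINT v:{u<..<1}|lebesgue. g v)"
    by (rule set_integral_Un[OF _ i1' i2']) auto
  also have "(LINT v:{0..u}|lebesgue. g v) = integral {0..u} g1"
    using i1' g1 by (subst set_lebesgue_integral_eq_integral(2)) (auto intro: integral_cong)
  also have "(LINT v:{u<..<1}|lebesgue. g v) = integral {u<..<1} g2"
    using i2' g2 by (subst set_lebesgue_integral_eq_integral(2)) (auto intro: integral_cong)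
  also have "\<dots> = integral {u..1} g2"
    by (simp add: integral_open_interval_real)
  finally show ?thesis unfolding g1_def g2_def .
qed

text \<open>
  Integration by parts: the linear factor has derivative \<open>-1\<close>, so the antiderivative stops after
  two terms.
\<close>
lemma integral_norm_bernoulli_poly_times_linear:
  assumes "a \<le> b"
  shows "integral {a..b} (\<lambda>v. poly (norm_bernoulli_poly n) v * (u - v + c)) =
    (poly (norm_bernoulli_poly (Suc n)) b * (u - b + c) + poly (norm_bernoulli_poly (n + 2)) b) -
    (poly (norm_bernoulli_poly (Suc n)) a * (u - a + c) + poly (norm_bernoulli_poly (n + 2)) a)"
proof -
  have "((\<lambda>v. poly (norm_bernoulli_poly (Suc n)) v * (u - v + c) +
        poly (norm_bernoulli_poly (n + 2)) v)
      has_real_derivative poly (norm_bernoulli_poly n) v * (u - v + c)) (at v within {a..b})" for v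
    by (auto intro!: derivative_eq_intros simp: pderiv_norm_bernoulli_poly)
  then show ?thesis
    by (intro integral_unique fundamental_theorem_of_calculus assms)
      (simp add: has_real_derivative_iff_has_vector_derivative)
qed

lemma circ_conv_norm_bernoulli_poly:
  assumes n: "n \<ge> 1" and u: "u \<in> {0..<1}"
  shows "circ_conv (poly (norm_bernoulli_poly n)) (poly (norm_bernoulli_poly 1)) u =
    - poly (norm_bernoulli_poly (Suc n)) u"
proof -
  have per: "poly (norm_bernoulli_poly (Suc n)) 1 = poly (norm_bernoulli_poly (Suc n)) 0"
    "poly (norm_bernoulli_poly (n + 2)) 1 = poly (norm_bernoulli_poly (n + 2)) 0"
    using norm_bernoulli_poly_jump[of "Suc n"] norm_bernoulli_poly_jump[of "n + 2"] n by auto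
  let ?b = "\<lambda>n. poly (norm_bernoulli_poly n)"
  have "continuous_on {0..1} (?b n)" by (intro continuous_intros)
  then have "circ_conv (?b n) (?b 1) u =
      integral {0..u} (\<lambda>v. ?b n v * (u - v + - 1 / 2)) +
      integral {u..1} (\<lambda>v. ?b n v * (u - v + 1 / 2))"
    unfolding norm_bernoulli_poly_1 by (subst circ_conv_sawtooth[OF u]) simp_all
  also have "\<dots> = - ?b (Suc n) u"
    using u by (subst (1 2) integral_norm_bernoulli_poly_times_linear)
      (simp_all only: per, auto simp: field_simps)
  finally show ?thesis .
qed

lemma circ_power_norm_bernoulli_poly_1:
  assumes "x \<in> {0..<1}"
  shows "circ_power (poly (norm_bernoulli_poly 1)) (Suc n) x =
    (- 1) ^ n * poly (norm_bernoulli_poly (Suc n)) x"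
  using assms
proof (induction n arbitrary: x)
  case 0
  then show ?case by simp
next
  case (Suc n)
  let ?b = "\<lambda>n. poly (norm_bernoulli_poly n)"
  have "circ_power (?b 1) (Suc (Suc n)) x =
      (LINT v:{0..<1}|lebesgue. (- 1) ^ n * (?b (Suc n) v * ?b 1 (frac (x - v))))"
    unfolding circ_power.simps(2) circ_conv_def
    by (intro set_lebesgue_integral_cong) (simp_all add: Suc.IH del: One_nat_def)
  also have "\<dots> = (- 1) ^ n * circ_conv (?b (Suc n)) (?b 1) x"
    by (simp add: circ_conv_def)
  also have "\<dots> = (- 1) ^ Suc n * ?b (Suc (Suc n)) x"
    using Suc.prems by (subst circ_conv_norm_bernoulli_poly) auto
  finally show ?case .
qed

lemma poly_eqI_infinite:
  fixes p q :: "'a::idom poly"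
  assumes "infinite A" "\<And>x. x \<in> A \<Longrightarrow> poly p x = poly q x"
  shows "p = q"
proof (rule ccontr)
  assume "p \<noteq> q"
  then have "finite {x. poly (p - q) x = 0}" by (intro poly_roots_finite) simp
  moreover have "A \<subseteq> {x. poly (p - q) x = 0}" using assms(2) by auto
  ultimately show False using assms(1) finite_subset by blast
qed

section \<open>Characterization by convolution powers\<close>

theorem theorem1p1:
  fixes p :: "nat \<Rightarrow> real poly"
  shows "(p 0 = 1 \<and> p 1 = [:- 1 / 2, 1:] \<and>
          (\<forall>n\<ge>1. \<forall>x\<in>{0..<1}. poly (p n) x = (- 1) ^ (n - 1) * circ_power (poly (p 1)) n x))
         \<longleftrightarrow> (\<forall>n. p n = norm_bernoulli_poly n)"
proof -
  have pow: "(- 1) ^ (n - 1) * circ_power (poly [:- 1 / 2, 1:]) n x =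
      poly (norm_bernoulli_poly n) x" if "n \<ge> 1" "x \<in> {0..<1}" for n x
  proof -
    from that obtain m where "n = Suc m" by (cases n) auto
    then show ?thesis
      using circ_power_norm_bernoulli_poly_1[OF that(2), of m] unfolding norm_bernoulli_poly_1
      by (simp flip: mult.assoc power_add)
  qed
  show ?thesis
  proof (intro iffI allI)
    fix n
    assume p: "p 0 = 1 \<and> p 1 = [:- 1 / 2, 1:] \<and>
      (\<forall>n\<ge>1. \<forall>x\<in>{0..<1}. poly (p n) x = (- 1) ^ (n - 1) * circ_power (poly (p 1)) n x)"
    show "p n = norm_bernoulli_poly n"
    proof (cases "n = 0")
      case True
      with p show ?thesis by (simp add: norm_bernoulli_poly_0)
    next
      case False
      have "poly (p n) x = poly (norm_bernoulli_poly n) x" if "x \<in> {0..<1}" for x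
        using p pow[of n x] that False by simp
      moreover have "infinite {0..<1::real}" by simp
      ultimately show ?thesis using poly_eqI_infinite by blast
    qed
  next
    assume p: "\<forall>n. p n = norm_bernoulli_poly n"
    show "p 0 = 1 \<and> p 1 = [:- 1 / 2, 1:] \<and>
      (\<forall>n\<ge>1. \<forall>x\<in>{0..<1}. poly (p n) x = (- 1) ^ (n - 1) * circ_power (poly (p 1)) n x)"
    proof (intro conjI allI ballI impI)
      show "p 0 = 1" using p norm_bernoulli_poly_0 by simp
      show p1: "p 1 = [:- 1 / 2, 1:]" using p norm_bernoulli_poly_1 by simp
      fix n :: nat and x :: real
      assume "n \<ge> 1" "x \<in> {0..<1}"
      from pow[OF this] p
      show "poly (p n) x = (- 1) ^ (n - 1) * circ_power (poly (p 1)) n x"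
        unfolding p1 by metis
    qed
  qed
qed

end
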